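(* Let $n\ge 1$ and let $(\xi_i,\mathfrak{F}_i)_{i=0,\dots,n}$ be a sequence of real-valued martingale differences with $\xi_0=0$ and $\mathfrak F_0$ trivial, and let $S_n=\sum_{i=1}^n\xi_i$. If, for some $\beta\in(1,2)$, $\mathbb{E}|\xi_i|^\beta<\infty$ for all $i$, then for all $x>0$, \[ \mathbb{P}\Big(\frac{S_n}{G_n(\beta)}\geq x\Big) \leq\inf_{p>1}\Big(\mathbb{E}\Big[\exp\Big\{(p-1)\Big(\frac{x}{\beta}\Big)^{\frac{\beta}{\beta-1}}(1-\beta)G_n(\beta)\Big\}1_{\{S_n\geq xG_n(\beta)\}}\Big]\Big)^{1/p} \] \[ \leq\inf_{p>1}\Big(\mathbb{E}\Big[\exp\Big\{(p-1)\Big(\frac{x}{\beta}\Big)^{\frac{\beta}{\beta-1}}(1-\beta)G_n(\beta)\Big\}\Big]\Big)^{1/p}. \]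
   Context: $(\Omega,\mathfrak F,\mathbb P)$ is a probability space with increasing $\sigma$-fields $\{\emptyset,\Omega\}=\mathfrak F_0\subseteq\cdots\subseteq\mathfrak F_n\subseteq\mathfrak F$; each $\xi_i$ is $\mathfrak F_i$-measurable and integrable with $\mathbb E[\xi_i\mid\mathfrak F_{i-1}]=0$ for $i\ge1$. With $\xi_i^{+}=\max\{\xi_i,0\}$ and $\xi_i^{-}=\max\{-\xi_i,0\}$, \[G_n(\beta)=\sum_{i=1}^{n}(\xi_i^{+})^\beta+\sum_{i=1}^{n}\mathbb{E}[(\xi_i^{-})^\beta|\mathfrak{F}_{i-1}].\] *)

theory Defs
  imports "HOL-Probability.Probability"
begin

definition mart_diff ::
  "'a measure \<Rightarrow> nat \<Rightarrow> (nat \<Rightarrow> 'a measure) \<Rightarrow> (nat \<Rightarrow> 'a \<Rightarrow> real) \<Rightarrow> bool" where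
  "mart_diff M n F \<xi> \<longleftrightarrow>
     (\<forall>i\<le>n. subalgebra M (F i)) \<and>
     (\<forall>i\<le>n. \<forall>j\<le>i. sets (F j) \<subseteq> sets (F i)) \<and>
     (\<forall>i\<le>n. \<xi> i \<in> borel_measurable (F i)) \<and>
     (\<forall>i\<le>n. integrable M (\<xi> i)) \<and>
     (\<forall>i\<in>{1..n}. AE \<omega> in M. real_cond_exp M (F (i - 1)) (\<xi> i) \<omega> = 0)"

definition part_sum :: "nat \<Rightarrow> (nat \<Rightarrow> 'a \<Rightarrow> real) \<Rightarrow> 'a \<Rightarrow> real" where
  "part_sum n \<xi> \<omega> = (\<Sum>i=1..n. \<xi> i \<omega>)"

(* A version of the conditional expectations is fixed by real_cond_exp; G is therefore
   nonnegative only almost surely. On {G = 0} also S = 0 almost surely, and S / G then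
   follows the HOL convention 0 / 0 = 0. *)
definition G ::
  "'a measure \<Rightarrow> nat \<Rightarrow> (nat \<Rightarrow> 'a measure) \<Rightarrow> (nat \<Rightarrow> 'a \<Rightarrow> real) \<Rightarrow> real \<Rightarrow> 'a \<Rightarrow> real" where
  "G M n F \<xi> \<beta> \<omega> =
     (\<Sum>i=1..n. max (\<xi> i \<omega>) 0 powr \<beta>) +
     (\<Sum>i=1..n. real_cond_exp M (F (i - 1)) (\<lambda>\<omega>'. max (- \<xi> i \<omega>') 0 powr \<beta>) \<omega>)"

end

theory Submission
  imports Defs
begin

text \<open>
  The bound comes from an exponential supermartingale that charges the upward jumps to their actual
  \<open>\<beta>\<close>-th powers and the downward jumps only to their conditional \<open>\<beta>\<close>-th moments.  This works
  because of the elementary inequality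
  \<open>exp (t - (t\<^sup>+)\<^sup>\<beta>) \<le> 1 + t + (t\<^sup>-)\<^sup>\<beta>\<close> for \<open>1 \<le> \<beta> \<le> 2\<close>
  (\<open>exp_diff_pos_part_powr_le\<close>).  Put \<open>t = \<lambda> \<xi>\<^sub>i\<close> and take conditional expectations: the
  linear term disappears, and the rest is at most \<open>exp (\<lambda>\<^sup>\<beta> E[(\<xi>\<^sub>i\<^sup>-)\<^sup>\<beta> | F\<^sub>i\<^sub>-\<^sub>1])\<close> by \<open>1 + u \<le> exp u\<close>,
  which is exactly what the predictable part of \<open>G\<close> compensates.  Hence
  \<open>E[exp (\<lambda> S\<^sub>n - \<lambda>\<^sup>\<beta> G\<^sub>n)] \<le> 1\<close> for every \<open>\<lambda> > 0\<close> (\<open>expectation_exp_part_sum_le_1\<close>).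

  On \<open>A = {S\<^sub>n \<ge> x G\<^sub>n}\<close> the exponent is at least \<open>(\<lambda> x - \<lambda>\<^sup>\<beta>) G\<^sub>n\<close>.  The choice
  \<open>\<lambda> = (x/\<beta>)\<^bsup>1/(\<beta>-1)\<^esup>\<close> maximises the coefficient, with value \<open>c = (\<beta> - 1) (x/\<beta>)\<^bsup>\<beta>/(\<beta>-1)\<^esup>\<close>.
  Write \<open>1\<^sub>A\<close> as at most \<open>exp ((\<lambda> S\<^sub>n - \<lambda>\<^sup>\<beta> G\<^sub>n) / q) * exp (- c G\<^sub>n / q) 1\<^sub>A\<close> with \<open>1/p + 1/q = 1\<close>.
  Hoelder's inequality then leaves the factor
  \<open>(E[exp (- (p - 1) c G\<^sub>n) 1\<^sub>A])\<^bsup>1/p\<^esup>\<close>, because \<open>p / q = p - 1\<close>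
  (\<open>measure_le_exp_tilted_powr\<close>).  Finally \<open>{S\<^sub>n / G\<^sub>n \<ge> x}\<close> lies in \<open>A\<close> up to a null set, since
  \<open>G\<^sub>n \<ge> 0\<close> almost surely, and dropping \<open>1\<^sub>A\<close> gives the second bound.
\<close>

section \<open>The pointwise inequality\<close>

text \<open>
  Below modulus \<open>1\<close> the power \<open>\<bar>t\<bar> powr \<beta>\<close> dominates \<open>t\<^sup>2\<close>, so a second-order estimate of the
  exponential suffices; above it dominates \<open>\<bar>t\<bar>\<close>, and the linear term is absorbed altogether.
\<close>

lemma exp_diff_pos_part_powr_le:
  fixes t \<beta> :: real
  assumes "1 \<le> \<beta>" "\<beta> \<le> 2"
  shows "exp (t - max t 0 powr \<beta>) \<le> 1 + t + max (- t) 0 powr \<beta>"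
proof (cases "t \<ge> 0")
  case True
  have "t - t powr \<beta> \<le> ln (1 + t)"
  proof (cases "t \<le> 1")
    case small: True
    have "t\<^sup>2 \<le> t powr \<beta>"
      using True small assms powr_mono'[of \<beta> 2 t] by (cases "t = 0") auto
    then show ?thesis
      using ln_one_plus_pos_lower_bound[OF True small] by simp
  next
    case False
    have "t \<le> t powr \<beta>"
      using False assms powr_mono[of 1 \<beta> t] by simp
    moreover have "0 \<le> ln (1 + t)"
      using True by simp
    ultimately show ?thesis by linarith
  qed
  then have "exp (t - t powr \<beta>) \<le> exp (ln (1 + t))"
    by simp
  then show ?thesis
    using True by simp
next
  case False
  define s where "s = - t"
  have s: "s > 0" using False by (simp add: s_def)
  have "exp (- s) \<le> 1 - s + s powr \<beta>"
  proof (cases "s \<le> 1")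
    case True
    (* the product is 1 + s ^ 3; this turns 1 + s \<le> exp s into an upper bound for exp (- s) *)
    have "1 \<le> (1 + s) * (1 - s + s\<^sup>2)"
      using s by (simp add: algebra_simps power2_eq_square)
    moreover have "0 < 1 - s + s\<^sup>2"
      using True s by (simp add: add_nonneg_pos)
    ultimately have "1 \<le> exp s * (1 - s + s\<^sup>2)"
      using mult_right_mono[OF exp_ge_add_one_self[of s], of "1 - s + s\<^sup>2"] by linarith
    then have "exp (- s) \<le> 1 - s + s\<^sup>2"
      by (simp add: exp_minus field_simps)
    moreover have "s\<^sup>2 \<le> s powr \<beta>"
      using s True assms powr_mono'[of \<beta> 2 s] by auto
    ultimately show ?thesis by linarith
  next
    case False
    have "s \<le> s powr \<beta>"
      using False assms powr_mono[of 1 \<beta> s] by simp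
    moreover have "exp (- s) \<le> 1"
      using s by simp
    ultimately show ?thesis by linarith
  qed
  then show ?thesis
    using False by (simp add: s_def)
qed

lemma diff_pos_part_powr_le_1:
  fixes t \<beta> :: real
  assumes "1 \<le> \<beta>"
  shows "t - max t 0 powr \<beta> \<le> 1"
proof (cases "t \<le> 1")
  case True
  then show ?thesis
    using powr_ge_zero[of "max t 0" \<beta>] by linarith
next
  case False
  then show ?thesis
    using powr_mono[of 1 \<beta> t] assms by simp
qed

lemma max_mult_powr:
  fixes t l \<beta> :: real
  assumes "l > 0"
  shows "max (l * t) 0 powr \<beta> = l powr \<beta> * max t 0 powr \<beta>"
proof -
  have "max (l * t) 0 = l * max t 0"
    using assms by (auto simp: max_def mult_le_0_iff)
  then show ?thesis
    using assms by (simp add: powr_mult)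
qed

section \<open>One step of the exponential supermartingale\<close>

text \<open>
  The compensator \<open>exp (- l powr \<beta> * E[(\<xi>\<^sup>-) powr \<beta> | F])\<close> is \<open>F\<close>-measurable, so it can be merged
  with \<open>Z\<close> and pulled through the conditional expectation.  Boundedness of \<open>Z\<close> makes all products
  integrable although \<open>\<xi>\<close> itself may be unbounded.
\<close>

lemma (in finite_measure_subalgebra) integral_exp_step_le:
  fixes Z \<xi> :: "'a \<Rightarrow> real" and K l \<beta> :: real
  defines "C \<equiv> real_cond_exp M F (\<lambda>\<omega>. max (- \<xi> \<omega>) 0 powr \<beta>)"
  assumes Z[measurable]: "Z \<in> borel_measurable F"
    and Z0: "\<And>\<omega>. 0 \<le> Z \<omega>" and ZK: "AE \<omega> in M. Z \<omega> \<le> K"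
    and \<xi>[measurable]: "integrable M \<xi>" and \<xi>0: "AE \<omega> in M. real_cond_exp M F \<xi> \<omega> = 0"
    and neg[measurable]: "integrable M (\<lambda>\<omega>. max (- \<xi> \<omega>) 0 powr \<beta>)"
    and \<beta>: "1 \<le> \<beta>" "\<beta> \<le> 2" and l: "l > 0"
  shows "(\<integral>\<omega>. Z \<omega> * exp (l * \<xi> \<omega> - l powr \<beta> * max (\<xi> \<omega>) 0 powr \<beta> - l powr \<beta> * C \<omega>) \<partial>M)
         \<le> (\<integral>\<omega>. Z \<omega> \<partial>M)"
proof -
  define \<eta> where "\<eta> = (\<lambda>\<omega>. max (- \<xi> \<omega>) 0 powr \<beta>)"
  define W where "W = (\<lambda>\<omega>. Z \<omega> * exp (- (l powr \<beta> * C \<omega>)))"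
  have [measurable]: "Z \<in> borel_measurable M" "C \<in> borel_measurable F" "C \<in> borel_measurable M"
    using measurable_from_subalg[OF subalg Z] by (simp_all add: C_def)
  have WF[measurable]: "W \<in> borel_measurable F"
    unfolding W_def by measurable
  have [measurable]: "W \<in> borel_measurable M"
    using measurable_from_subalg[OF subalg WF] .
  have \<eta>i[measurable]: "integrable M \<eta>"
    using neg by (simp add: \<eta>_def)
  have C0: "AE \<omega> in M. 0 \<le> C \<omega>"
    unfolding C_def by (rule real_cond_exp_pos) (use neg in auto)
  have W0: "0 \<le> W \<omega>" for \<omega>
    using Z0 by (simp add: W_def)
  have WK: "AE \<omega> in M. W \<omega> \<le> K"
    using ZK C0
  proof eventually_elim
    case (elim \<omega>)
    have "W \<omega> \<le> Z \<omega> * 1"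
      unfolding W_def using elim l Z0 by (intro mult_left_mono) auto
    then show ?case using elim by simp
  qed
  have bounded_mult: "integrable M (\<lambda>\<omega>. W \<omega> * f \<omega>)" if [measurable]: "integrable M f" for f
  proof (rule Bochner_Integration.integrable_bound)
    show "integrable M (\<lambda>\<omega>. K * f \<omega>)" using that by simp
    show "AE \<omega> in M. norm (W \<omega> * f \<omega>) \<le> norm (K * f \<omega>)"
      using WK by eventually_elim (use W0 in \<open>force simp: abs_mult intro!: mult_right_mono\<close>)
  qed measurable
  have iZ: "integrable M Z"
    by (rule integrable_const_bound[of _ K]) (use ZK Z0 in auto)
  have iW: "integrable M W"
    by (rule integrable_const_bound[of _ K]) (use WK W0 in auto)
  have W\<xi>: "(\<integral>\<omega>. W \<omega> * \<xi> \<omega> \<partial>M) = 0"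
  proof -
    have "(\<integral>\<omega>. W \<omega> * \<xi> \<omega> \<partial>M) = (\<integral>\<omega>. W \<omega> * real_cond_exp M F \<xi> \<omega> \<partial>M)"
      by (rule real_cond_exp_intg(2)[symmetric]) (use bounded_mult[OF \<xi>] in auto)
    also have "\<dots> = 0"
      by (rule integral_eq_zero_AE) (use \<xi>0 in auto)
    finally show ?thesis .
  qed
  have W\<eta>: "(\<integral>\<omega>. W \<omega> * \<eta> \<omega> \<partial>M) = (\<integral>\<omega>. W \<omega> * C \<omega> \<partial>M)" and iWC: "integrable M (\<lambda>\<omega>. W \<omega> * C \<omega>)"
    using real_cond_exp_intg[OF bounded_mult[OF \<eta>i] WF] by (simp_all add: C_def \<eta>_def)
  let ?R = "\<lambda>\<omega>. W \<omega> + l * (W \<omega> * \<xi> \<omega>) + l powr \<beta> * (W \<omega> * \<eta> \<omega>)"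
  let ?L = "\<lambda>\<omega>. Z \<omega> * exp (l * \<xi> \<omega> - l powr \<beta> * max (\<xi> \<omega>) 0 powr \<beta> - l powr \<beta> * C \<omega>)"
  have iR: "integrable M ?R"
    using iW bounded_mult[OF \<xi>] bounded_mult[OF \<eta>i] by simp
  have LR: "?L \<omega> \<le> ?R \<omega>" for \<omega>
  proof -
    have "?L \<omega> = W \<omega> * exp (l * \<xi> \<omega> - max (l * \<xi> \<omega>) 0 powr \<beta>)"
      using l by (simp add: W_def max_mult_powr mult.assoc mult_exp_exp)
    also have "\<dots> \<le> W \<omega> * (1 + l * \<xi> \<omega> + max (- (l * \<xi> \<omega>)) 0 powr \<beta>)"
      using W0 \<beta> by (intro mult_left_mono exp_diff_pos_part_powr_le) auto
    also have "\<dots> = ?R \<omega>"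
      using l max_mult_powr[of l "- \<xi> \<omega>" \<beta>] by (simp add: \<eta>_def algebra_simps)
    finally show ?thesis .
  qed
  have iL: "integrable M ?L"
  proof (rule Bochner_Integration.integrable_bound[OF iR])
    show "AE \<omega> in M. norm (?L \<omega>) \<le> norm (?R \<omega>)"
      using LR Z0 by (auto intro!: AE_I2 order_trans[OF LR])
  qed measurable
  have "integral\<^sup>L M ?L \<le> integral\<^sup>L M ?R"
    by (rule integral_mono[OF iL iR LR])
  also have "\<dots> = (\<integral>\<omega>. W \<omega> \<partial>M) + l powr \<beta> * (\<integral>\<omega>. W \<omega> * C \<omega> \<partial>M)"
    using iW bounded_mult[OF \<xi>] bounded_mult[OF \<eta>i] W\<xi> W\<eta> by simp
  also have "\<dots> = (\<integral>\<omega>. W \<omega> + l powr \<beta> * (W \<omega> * C \<omega>) \<partial>M)"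
    using iW iWC by simp
  also have "\<dots> \<le> (\<integral>\<omega>. Z \<omega> \<partial>M)"
  proof (rule integral_mono)
    fix \<omega>
    have "W \<omega> + l powr \<beta> * (W \<omega> * C \<omega>) = W \<omega> * (1 + l powr \<beta> * C \<omega>)"
      by (simp add: algebra_simps)
    also have "\<dots> \<le> W \<omega> * exp (l powr \<beta> * C \<omega>)"
      using W0 by (intro mult_left_mono) auto
    also have "\<dots> = Z \<omega>"
      by (simp add: W_def exp_minus)
    finally show "W \<omega> + l powr \<beta> * (W \<omega> * C \<omega>) \<le> Z \<omega>" .
  qed (use iW iWC iZ in auto)
  finally show ?thesis .
qed

section \<open>The exponential supermartingale\<close>

lemma part_sum_Suc: "part_sum (Suc k) \<xi> \<omega> = part_sum k \<xi> \<omega> + \<xi> (Suc k) \<omega>"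
  by (simp add: part_sum_def)

lemma G_Suc:
  "G M (Suc k) F \<xi> \<beta> \<omega> = G M k F \<xi> \<beta> \<omega> + max (\<xi> (Suc k) \<omega>) 0 powr \<beta>
     + real_cond_exp M (F k) (\<lambda>\<omega>'. max (- \<xi> (Suc k) \<omega>') 0 powr \<beta>) \<omega>"
  by (simp add: G_def)

lemma mart_diff_subalgebra:
  assumes "mart_diff M n F \<xi>" "j \<le> i" "i \<le> n"
  shows "subalgebra (F i) (F j)"
  using assms unfolding mart_diff_def subalgebra_def by (metis order_trans)

lemma mart_diff_adapted:
  assumes md: "mart_diff M n F \<xi>" and k: "k \<le> n"
  shows "part_sum k \<xi> \<in> borel_measurable (F k)" "G M k F \<xi> \<beta> \<in> borel_measurable (F k)"
proof -
  have meas_\<xi>: "\<xi> i \<in> borel_measurable (F k)" if "i \<in> {1..k}" for i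
  proof (rule measurable_from_subalg[OF mart_diff_subalgebra[OF md]])
    show "\<xi> i \<in> borel_measurable (F i)" using md that k by (auto simp: mart_diff_def)
  qed (use that k in auto)
  have "real_cond_exp M (F (i - 1)) f \<in> borel_measurable (F k)" if "i \<in> {1..k}" for i f
    using that k by (intro measurable_from_subalg[OF mart_diff_subalgebra[OF md, of "i - 1" k]]
        borel_measurable_cond_exp) auto
  then show "part_sum k \<xi> \<in> borel_measurable (F k)" "G M k F \<xi> \<beta> \<in> borel_measurable (F k)"
    unfolding part_sum_def[abs_def] G_def[abs_def] using meas_\<xi>
    by (auto intro!: borel_measurable_sum borel_measurable_add powr_real_measurable
          borel_measurable_max)
qed

lemma mart_diff_measurable:
  assumes "mart_diff M n F \<xi>" "k \<le> n"
  shows "part_sum k \<xi> \<in> borel_measurable M" "G M k F \<xi> \<beta> \<in> borel_measurable M"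
    and "i \<le> n \<Longrightarrow> \<xi> i \<in> borel_measurable M"
proof -
  have sub: "subalgebra M (F i)" if "i \<le> n" for i
    using assms(1) that by (simp add: mart_diff_def)
  show "part_sum k \<xi> \<in> borel_measurable M" "G M k F \<xi> \<beta> \<in> borel_measurable M"
    using mart_diff_adapted[OF assms] sub[OF assms(2)] by (auto intro: measurable_from_subalg)
  show "\<xi> i \<in> borel_measurable M" if "i \<le> n"
    using assms(1) that sub[OF that] by (auto simp: mart_diff_def intro: measurable_from_subalg)
qed

lemma AE_real_cond_exp_neg_part_nonneg:
  assumes "prob_space M" "mart_diff M n F \<xi>" "i \<in> {1..n}"
  shows "AE \<omega> in M. 0 \<le> real_cond_exp M (F (i - 1)) (\<lambda>\<omega>'. max (- \<xi> i \<omega>') 0 powr \<beta>) \<omega>"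
proof -
  interpret prob_space M by fact
  have "subalgebra M (F (i - 1))"
    using assms by (auto simp: mart_diff_def)
  then interpret S: finite_measure_subalgebra M "F (i - 1)"
    by unfold_locales
  have [measurable]: "\<xi> i \<in> borel_measurable M"
    using mart_diff_measurable(3)[OF assms(2) order_refl] assms(3) by simp
  show ?thesis
    by (rule S.real_cond_exp_pos) auto
qed

lemma AE_G_nonneg:
  assumes "prob_space M" "mart_diff M n F \<xi>"
  shows "AE \<omega> in M. 0 \<le> G M n F \<xi> \<beta> \<omega>"
proof -
  have "AE \<omega> in M. \<forall>i\<in>{1..n}. 0 \<le> real_cond_exp M (F (i - 1)) (\<lambda>\<omega>'. max (- \<xi> i \<omega>') 0 powr \<beta>) \<omega>"
    by (rule AE_finite_allI) (simp, rule AE_real_cond_exp_neg_part_nonneg[OF assms])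
  then show ?thesis
    unfolding G_def by eventually_elim (intro add_nonneg_nonneg sum_nonneg; simp)
qed

text \<open>
  Each summand contributes at most \<open>1\<close> to the exponent, because \<open>t - (t\<^sup>+) powr \<beta> \<le> 1\<close>.  The resulting
  crude bound grows with \<open>k\<close>; it serves only to secure integrability.
\<close>

lemma AE_exponent_le:
  fixes l \<beta> :: real
  assumes "prob_space M" "mart_diff M n F \<xi>" "1 \<le> \<beta>" "l > 0" "k \<le> n"
  shows "AE \<omega> in M. l * part_sum k \<xi> \<omega> - l powr \<beta> * G M k F \<xi> \<beta> \<omega> \<le> k"
  using \<open>k \<le> n\<close>
proof (induction k)
  case 0
  then show ?case by (simp add: part_sum_def G_def)
next
  case (Suc k)
  have "AE \<omega> in M. 0 \<le> real_cond_exp M (F k) (\<lambda>\<omega>'. max (- \<xi> (Suc k) \<omega>') 0 powr \<beta>) \<omega>"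
    using AE_real_cond_exp_neg_part_nonneg[OF assms(1,2), of "Suc k"] Suc.prems by simp
  moreover have "AE \<omega> in M. l * part_sum k \<xi> \<omega> - l powr \<beta> * G M k F \<xi> \<beta> \<omega> \<le> k"
    using Suc by simp
  ultimately show ?case
  proof eventually_elim
    case (elim \<omega>)
    have "l * \<xi> (Suc k) \<omega> - l powr \<beta> * max (\<xi> (Suc k) \<omega>) 0 powr \<beta> \<le> 1"
      using diff_pos_part_powr_le_1[OF assms(3), of "l * \<xi> (Suc k) \<omega>"] assms(4)
      by (simp add: max_mult_powr)
    moreover have "0 \<le> l powr \<beta> * real_cond_exp M (F k) (\<lambda>\<omega>'. max (- \<xi> (Suc k) \<omega>') 0 powr \<beta>) \<omega>"
      using elim by simp
    ultimately show ?case
      using elim unfolding part_sum_Suc G_Suc distrib_left of_nat_Suc by linarith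
  qed
qed

lemma integrable_exp_part_sum:
  fixes l \<beta> :: real
  assumes "prob_space M" "mart_diff M n F \<xi>" "1 \<le> \<beta>" "l > 0" "k \<le> n"
  shows "integrable M (\<lambda>\<omega>. exp (l * part_sum k \<xi> \<omega> - l powr \<beta> * G M k F \<xi> \<beta> \<omega>))"
proof -
  interpret prob_space M by fact
  note [measurable] = mart_diff_measurable(1,2)[OF assms(2,5)]
  show ?thesis
    by (rule integrable_const_bound[of _ "exp k"]) (use AE_exponent_le[OF assms] in auto)
qed

lemma expectation_exp_part_sum_le_1:
  fixes l \<beta> :: real
  assumes "prob_space M" and md: "mart_diff M n F \<xi>"
    and \<beta>: "1 \<le> \<beta>" "\<beta> \<le> 2" and l: "l > 0"
    and int: "\<forall>i\<le>n. integrable M (\<lambda>\<omega>. \<bar>\<xi> i \<omega>\<bar> powr \<beta>)"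
    and "k \<le> n"
  shows "(\<integral>\<omega>. exp (l * part_sum k \<xi> \<omega> - l powr \<beta> * G M k F \<xi> \<beta> \<omega>) \<partial>M) \<le> 1"
  using \<open>k \<le> n\<close>
proof (induction k)
  interpret prob_space M by fact
  case 0
  then show ?case by (simp add: part_sum_def G_def prob_space)
next
  interpret prob_space M by fact
  case (Suc k)
  have "subalgebra M (F k)"
    using md Suc.prems by (simp add: mart_diff_def)
  then interpret S: finite_measure_subalgebra M "F k"
    by unfold_locales
  let ?Z = "\<lambda>\<omega>. exp (l * part_sum k \<xi> \<omega> - l powr \<beta> * G M k F \<xi> \<beta> \<omega>)"
  have kn: "k \<le> n" using Suc.prems by simp
  note [measurable] = mart_diff_adapted[OF md kn]
  have [measurable]: "\<xi> (Suc k) \<in> borel_measurable M"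
    using mart_diff_measurable(3)[OF md order_refl Suc.prems] .
  have neg: "integrable M (\<lambda>\<omega>. max (- \<xi> (Suc k) \<omega>) 0 powr \<beta>)"
  proof (rule Bochner_Integration.integrable_bound)
    show "integrable M (\<lambda>\<omega>. \<bar>\<xi> (Suc k) \<omega>\<bar> powr \<beta>)"
      using int Suc.prems by simp
    show "AE \<omega> in M. norm (max (- \<xi> (Suc k) \<omega>) 0 powr \<beta>) \<le> norm (\<bar>\<xi> (Suc k) \<omega>\<bar> powr \<beta>)"
      using \<beta> by (auto intro!: AE_I2 powr_mono2)
  qed measurable
  have "(\<integral>\<omega>. exp (l * part_sum (Suc k) \<xi> \<omega> - l powr \<beta> * G M (Suc k) F \<xi> \<beta> \<omega>) \<partial>M) =
    (\<integral>\<omega>. ?Z \<omega> * exp (l * \<xi> (Suc k) \<omega> - l powr \<beta> * max (\<xi> (Suc k) \<omega>) 0 powr \<beta>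
       - l powr \<beta> * real_cond_exp M (F k) (\<lambda>\<omega>'. max (- \<xi> (Suc k) \<omega>') 0 powr \<beta>) \<omega>) \<partial>M)"
    by (intro Bochner_Integration.integral_cong refl)
       (simp add: part_sum_Suc G_Suc exp_add[symmetric] algebra_simps)
  also have "\<dots> \<le> (\<integral>\<omega>. ?Z \<omega> \<partial>M)"
  proof (rule S.integral_exp_step_le)
    show "AE \<omega> in M. ?Z \<omega> \<le> exp k"
      using AE_exponent_le[OF assms(1) md \<beta>(1) l kn] by simp
    show "integrable M (\<xi> (Suc k))"
      using md Suc.prems by (simp add: mart_diff_def)
    show "AE \<omega> in M. real_cond_exp M (F k) (\<xi> (Suc k)) \<omega> = 0"
      using md Suc.prems by (force simp: mart_diff_def)
  qed (use \<beta> l neg in auto)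
  also have "\<dots> \<le> 1"
    using Suc.IH kn by simp
  finally show ?case .
qed

section \<open>From the exponential moment to the tail\<close>

text \<open>
  This is Hoelder's inequality for \<open>1\<^sub>A \<le> exp (X / q) * exp (- Y / q) 1\<^sub>A\<close>, where \<open>q = p / (p - 1)\<close>
  and the first factor has \<open>q\<close>-norm at most \<open>1\<close>.  It is obtained from its pointwise source, the
  convexity of \<open>exp\<close>, after normalising by the integral \<open>B\<close> of the second factor.
\<close>

lemma (in finite_measure) measure_le_exp_tilted_powr:
  fixes X Y :: "'a \<Rightarrow> real" and p :: real
  assumes A[measurable]: "A \<in> sets M" and p: "p > 1"
    and X: "integrable M (\<lambda>\<omega>. exp (X \<omega>))" "(\<integral>\<omega>. exp (X \<omega>) \<partial>M) \<le> 1"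
    and H: "integrable M (\<lambda>\<omega>. exp (- (p - 1) * Y \<omega>) * indicator A \<omega>)"
    and YX: "\<And>\<omega>. \<omega> \<in> A \<Longrightarrow> Y \<omega> \<le> X \<omega>"
  shows "measure M A \<le> (\<integral>\<omega>. exp (- (p - 1) * Y \<omega>) * indicator A \<omega> \<partial>M) powr (1 / p)"
proof -
  define h where "h = (\<lambda>\<omega>. exp (- (p - 1) * Y \<omega>) * indicator A \<omega>)"
  define B where "B = (\<integral>\<omega>. h \<omega> \<partial>M)"
  have ih: "integrable M h"
    using H by (simp add: h_def)
  have h0: "0 \<le> h \<omega>" for \<omega>
    by (simp add: h_def)
  have B0: "0 \<le> B"
    unfolding B_def using h0 by simp
  have "measure M A \<le> B powr (1 / p)"
  proof (cases "B = 0")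
    case True
    then have "AE \<omega> in M. h \<omega> = 0"
      using integral_nonneg_eq_0_iff_AE[OF ih] h0 by (simp add: B_def)
    then have "AE \<omega> in M. \<omega> \<notin> A"
      by eventually_elim (auto simp: h_def split: split_indicator_asm)
    then have "measure M A = 0"
      using AE_iff_null_sets[OF A] by (simp add: measure_eq_0_null_sets)
    then show ?thesis by simp
  next
    case False
    then have B: "B > 0" using B0 by simp
    define s where "s = 1 / p"
    have s: "0 < s" "s < 1" using p by (auto simp: s_def)
    have sp: "s * (p - 1) = 1 - s" using p by (simp add: s_def field_simps)
    have pointwise: "B powr (- s) * indicator A \<omega> \<le> (1 - s) * exp (X \<omega>) + s * (h \<omega> / B)" for \<omega>
    proof (cases "\<omega> \<in> A")
      case True
      have "B powr (- s) = exp ((1 - s) * Y \<omega> + s * (- (p - 1) * Y \<omega> - ln B))"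
      proof -
        have "(1 - s) * Y \<omega> + s * (- (p - 1) * Y \<omega> - ln B)
            = (1 - s) * Y \<omega> - (s * (p - 1)) * Y \<omega> - s * ln B"
          by (simp add: algebra_simps)
        then show ?thesis
          unfolding sp using B by (simp add: powr_def)
      qed
      also have "\<dots> \<le> exp ((1 - s) * X \<omega> + s * (- (p - 1) * Y \<omega> - ln B))"
        using YX[OF True] s by (simp add: mult_left_mono)
      also have "\<dots> \<le> (1 - s) * exp (X \<omega>) + s * exp (- (p - 1) * Y \<omega> - ln B)"
        using convex_onD[OF exp_convex, of s "X \<omega>" "- (p - 1) * Y \<omega> - ln B"] s by simp
      also have "exp (- (p - 1) * Y \<omega> - ln B) = h \<omega> / B"
        using True B by (simp add: h_def exp_diff)
      finally show ?thesis using True by simp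
    next
      case False
      then show ?thesis using s B by (simp add: h_def)
    qed
    have iA: "integrable M (indicator A :: 'a \<Rightarrow> real)"
      using A by (intro integrable_real_indicator) (auto simp: emeasure_eq_measure)
    have "B powr (- s) * measure M A = (\<integral>\<omega>. B powr (- s) * indicator A \<omega> \<partial>M)"
      using A by simp
    also have "\<dots> \<le> (\<integral>\<omega>. (1 - s) * exp (X \<omega>) + s * (h \<omega> / B) \<partial>M)"
      using iA X(1) ih pointwise by (intro integral_mono) auto
    also have "\<dots> = (1 - s) * (\<integral>\<omega>. exp (X \<omega>) \<partial>M) + s * (B / B)"
      using X(1) ih by (simp add: B_def)
    also have "\<dots> \<le> (1 - s) * 1 + s * (B / B)"
      using X(2) s by (intro add_right_mono mult_left_mono) auto
    also have "\<dots> = 1"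
      using B by simp
    finally show ?thesis
      using B by (simp add: powr_minus field_simps s_def)
  qed
  then show ?thesis
    by (simp add: B_def h_def)
qed

theorem theorem2p4:
  fixes M :: "'a measure" and n :: nat and F :: "nat \<Rightarrow> 'a measure"
    and \<xi> :: "nat \<Rightarrow> 'a \<Rightarrow> real" and \<beta> x :: real
  assumes "prob_space M"
    and "n \<ge> 1"
    and "mart_diff M n F \<xi>"
    and "\<forall>\<omega>\<in>space M. \<xi> 0 \<omega> = 0"
    and "sets (F 0) = {{}, space M}"
    and "1 < \<beta>" and "\<beta> < 2"
    and "\<forall>i\<le>n. integrable M (\<lambda>\<omega>. \<bar>\<xi> i \<omega>\<bar> powr \<beta>)"
    and "x > 0"
  shows "measure M {\<omega> \<in> space M. part_sum n \<xi> \<omega> / G M n F \<xi> \<beta> \<omega> \<ge> x}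
      \<le> (INF p\<in>{1<..}.
           (\<integral>\<omega>. exp ((p - 1) * (x / \<beta>) powr (\<beta> / (\<beta> - 1)) * (1 - \<beta>) * G M n F \<xi> \<beta> \<omega>)
              * indicator {\<omega> \<in> space M. part_sum n \<xi> \<omega> \<ge> x * G M n F \<xi> \<beta> \<omega>} \<omega> \<partial>M)
           powr (1 / p))
    \<and> (INF p\<in>{1<..}.
           (\<integral>\<omega>. exp ((p - 1) * (x / \<beta>) powr (\<beta> / (\<beta> - 1)) * (1 - \<beta>) * G M n F \<xi> \<beta> \<omega>)
              * indicator {\<omega> \<in> space M. part_sum n \<xi> \<omega> \<ge> x * G M n F \<xi> \<beta> \<omega>} \<omega> \<partial>M)
           powr (1 / p))
      \<le> (INF p\<in>{1<..}.
           (\<integral>\<omega>. exp ((p - 1) * (x / \<beta>) powr (\<beta> / (\<beta> - 1)) * (1 - \<beta>) * G M n F \<xi> \<beta> \<omega>) \<partial>M)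
           powr (1 / p))"
proof -
  interpret prob_space M by fact
  let ?S = "part_sum n \<xi>" and ?G = "G M n F \<xi> \<beta>"
  define b where "b = (x / \<beta>) powr (\<beta> / (\<beta> - 1))"
  define A where "A = {\<omega> \<in> space M. ?S \<omega> \<ge> x * ?G \<omega>}"
  define E where "E = (\<lambda>p \<omega>. exp ((p - 1) * b * (1 - \<beta>) * ?G \<omega>))"
  note [measurable] = mart_diff_measurable(1,2)[OF assms(3) order_refl]
  have A[measurable]: "A \<in> sets M"
    unfolding A_def by measurable
  have G0: "AE \<omega> in M. 0 \<le> ?G \<omega>"
    by (rule AE_G_nonneg[OF assms(1,3)])
  have b0: "b > 0"
    using assms by (simp add: b_def)
  have iE: "integrable M (E p)" if "p > 1" for p
  proof (rule integrable_const_bound[of _ 1])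
    show "AE \<omega> in M. norm (E p \<omega>) \<le> 1"
      using G0
    proof eventually_elim
      case (elim \<omega>)
      have "(p - 1) * b * (\<beta> - 1) * ?G \<omega> \<ge> 0"
        using elim that b0 assms by simp
      then show ?case by (simp add: E_def algebra_simps)
    qed
  qed (simp add: E_def)
  have iEA: "integrable M (\<lambda>\<omega>. E p \<omega> * indicator A \<omega>)" if "p > 1" for p
    using integrable_mult_indicator[OF A iE[OF that]] by (simp add: mult.commute)
  have event: "measure M {\<omega> \<in> space M. ?S \<omega> / ?G \<omega> \<ge> x} \<le> measure M A"
  proof (rule finite_measure_mono_AE[OF _ A])
    show "AE \<omega> in M. \<omega> \<in> {\<omega> \<in> space M. ?S \<omega> / ?G \<omega> \<ge> x} \<longrightarrow> \<omega> \<in> A"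
      using G0
    proof eventually_elim
      case (elim \<omega>)
      show ?case
      proof
        assume \<omega>: "\<omega> \<in> {\<omega> \<in> space M. ?S \<omega> / ?G \<omega> \<ge> x}"
        (* if G vanishes, the quotient is 0 by convention and hence below x *)
        then have "?G \<omega> > 0"
          using elim \<open>x > 0\<close> by (cases "?G \<omega> = 0") auto
        then show "\<omega> \<in> A"
          using \<omega> by (simp add: A_def pos_le_divide_eq)
      qed
    qed
  qed
  (* the maximiser of l * x - l powr \<beta> *)
  define l where "l = (x / \<beta>) powr (1 / (\<beta> - 1))"
  have l: "l > 0"
    using assms by (simp add: l_def)
  have lb: "l powr \<beta> = b"
    using assms by (simp add: l_def b_def powr_powr)
  have "l powr (\<beta> - 1) = x / \<beta>"
    using assms by (simp add: l_def powr_powr)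
  then have "b = l * (x / \<beta>)"
    using l powr_add[of l 1 "\<beta> - 1"] by (simp flip: lb)
  then have lx: "l * x = \<beta> * b"
    using assms by simp
  have tail: "measure M {\<omega> \<in> space M. ?S \<omega> / ?G \<omega> \<ge> x}
      \<le> (\<integral>\<omega>. E p \<omega> * indicator A \<omega> \<partial>M) powr (1 / p)" if "p > 1" for p
  proof -
    have E_eq: "E p \<omega> = exp (- (p - 1) * (b * (\<beta> - 1) * ?G \<omega>))" for \<omega>
      by (simp add: E_def algebra_simps)
    have "measure M A \<le> (\<integral>\<omega>. E p \<omega> * indicator A \<omega> \<partial>M) powr (1 / p)"
      unfolding E_eq
    proof (rule measure_le_exp_tilted_powr[where X = "\<lambda>\<omega>. l * ?S \<omega> - l powr \<beta> * ?G \<omega>"])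
      show "integrable M (\<lambda>\<omega>. exp (l * ?S \<omega> - l powr \<beta> * ?G \<omega>))"
        using assms l by (intro integrable_exp_part_sum) auto
      show "(\<integral>\<omega>. exp (l * ?S \<omega> - l powr \<beta> * ?G \<omega>) \<partial>M) \<le> 1"
        using assms l by (intro expectation_exp_part_sum_le_1[where n = n]) auto
      show "integrable M (\<lambda>\<omega>. exp (- (p - 1) * (b * (\<beta> - 1) * ?G \<omega>)) * indicator A \<omega>)"
        using iEA[OF that] by (simp only: E_eq)
      show "b * (\<beta> - 1) * ?G \<omega> \<le> l * ?S \<omega> - l powr \<beta> * ?G \<omega>" if "\<omega> \<in> A" for \<omega>
      proof -
        have "l * (x * ?G \<omega>) \<le> l * ?S \<omega>"
          using that l by (simp add: A_def)
        then have "\<beta> * b * ?G \<omega> \<le> l * ?S \<omega>"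
          by (simp flip: lx)
        then show ?thesis
          by (simp add: lb algebra_simps)
      qed
    qed (use that in simp_all)
    then show ?thesis
      using event by linarith
  qed
  have "measure M {\<omega> \<in> space M. ?S \<omega> / ?G \<omega> \<ge> x}
      \<le> (INF p\<in>{1<..}. (\<integral>\<omega>. E p \<omega> * indicator A \<omega> \<partial>M) powr (1 / p))"
    by (rule cINF_greatest) (use tail in auto)
  moreover have "(INF p\<in>{1<..}. (\<integral>\<omega>. E p \<omega> * indicator A \<omega> \<partial>M) powr (1 / p))
      \<le> (INF p\<in>{1<..}. (\<integral>\<omega>. E p \<omega> \<partial>M) powr (1 / p))"
  proof (rule cINF_mono)
    show "bdd_below ((\<lambda>p. (\<integral>\<omega>. E p \<omega> * indicator A \<omega> \<partial>M) powr (1 / p)) ` {1<..})"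
      by (rule bdd_belowI2[where m = 0]) simp
    fix p :: real
    assume p: "p \<in> {1<..}"
    have "(\<integral>\<omega>. E p \<omega> * indicator A \<omega> \<partial>M) \<le> (\<integral>\<omega>. E p \<omega> \<partial>M)"
      using p by (intro integral_mono iE iEA) (auto simp: E_def split: split_indicator)
    then have "(\<integral>\<omega>. E p \<omega> * indicator A \<omega> \<partial>M) powr (1 / p) \<le> (\<integral>\<omega>. E p \<omega> \<partial>M) powr (1 / p)"
      using p by (intro powr_mono2) (auto simp: E_def)
    then show "\<exists>q\<in>{1<..}. (\<integral>\<omega>. E q \<omega> * indicator A \<omega> \<partial>M) powr (1 / q)
        \<le> (\<integral>\<omega>. E p \<omega> \<partial>M) powr (1 / p)"
      using p by blast
  qed simp
  ultimately show ?thesis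
    unfolding E_def A_def b_def by blast
qed

end
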